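(* Let $(G,Y)$ be a finite $C$-group. Then the factorization semigroup $S(G,Y)$ is stable, and $s_\Gamma^{e_\Gamma}$ is a stabilizing element: for all $s_1,s_2\in S(G,Y)$ with $\alpha_G(s_1)=\alpha_G(s_2)$ and $\tau(s_1)=\tau(s_2)$ one has $s_1\cdot s_\Gamma^{e_\Gamma}=s_2\cdot s_\Gamma^{e_\Gamma}$.
   Context: An equipped group is a pair $(G,O)$, $G$ a group, $O\subset G$ a union of finitely many conjugacy classes, $1\notin O$. A $C$-group is an equipped group $(G,Y)$ such that $G$ has a presentation with generators the elements of $Y$ and defining relations all of the form $z^{-1}yz=y'$ ($y,y',z\in Y$); it is finite if $Y$ is finite. The factorization semigroup $S(G,Y)$ is generated by symbols $x_y$, $y\in Y$, subject to $x_{g_1}x_{g_2}=x_{g_2}x_{g_2^{-1}g_1g_2}=x_{g_1g_2g_1^{-1}}x_{g_1}$ for $g_1,g_2\in Y$; $\alpha_G(x_y)=y$ extends to the product homomorphism $\alpha_G:S(G,Y)\to G$. The length $ln(s)$ is the number of factors $x_y$ in any expression of $s$. Write $Y=C_1\sqcup\dots\sqcup C_m$ as the decomposition into conjugacy classes of $G$, with fixed enumerations $C_i=\{y_{i,1},\dots,y_{i,n_i}\}$; let $p_i$ be the least $p\ge1$ with $y^p$ central in $G$ for $y\in C_i$ (independent of $y\in C_i$). The type is $\tau(s)=(\tau_1(s),\dots,\tau_m(s))$, where $\tau_i(s)$ is the number of factors of $s$ lying in $\{x_y:y\in C_i\}$. The canonical element is $s_\Gamma=\prod_{i=1}^m\prod_{j=1}^{n_i}x_{y_{i,j}}^{p_i}$.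 Elements $s_1,s_2$ are equivalent ($s_1\sim s_2$) if $s_3s_1s_4=s_3s_2s_4$ for some $s_3,s_4$; for equivalent $s_1,s_2$ let $e(s_1,s_2)$ be the least length of an $s$ with $s_1s=s_2s$ (such $s$ exists). Let $R$ be the set of elements $\prod_{i=1}^m\prod_{j=1}^{n_i}x_{y_{i,j}}^{k_{i,j}}$ (product in this fixed order, $k_{i,j}\ge0$) with $\sum_{j}k_{i,j}\le p_in_i$ for each $i$, let $E=\{(s_1,s_2)\in R^2: s_1\sim s_2\}$ and $e_\Gamma=\max_{(s_1,s_2)\in E}e(s_1,s_2)$. The semigroup $S(G,Y)$ is stable if there is $s\in S(G,Y)$ with $s_1s=s_2s$ for all $s_1,s_2$ satisfying $\alpha_G(s_1)=\alpha_G(s_2)$ and $\tau(s_1)=\tau(s_2)$; such $s$ is a stabilizing element. *)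

theory Defs
  imports "HOL-Algebra.Group"
begin

definition letter_val :: "('g, 'b) monoid_scheme \<Rightarrow> 'g \<times> bool \<Rightarrow> 'g" where
  "letter_val G l = (if snd l then fst l else inv\<^bsub>G\<^esub> (fst l))"

definition word_eval :: "('g, 'b) monoid_scheme \<Rightarrow> ('g \<times> bool) list \<Rightarrow> 'g" where
  "word_eval G w = foldr (\<lambda>l acc. letter_val G l \<otimes>\<^bsub>G\<^esub> acc) w \<one>\<^bsub>G\<^esub>"

definition Y_letters :: "'g set \<Rightarrow> ('g \<times> bool) list \<Rightarrow> bool" where
  "Y_letters Y w \<longleftrightarrow> fst ` set w \<subseteq> Y"

text \<open>Equality in the group presented by generators Y and the defining relations
  z^-1 y z = y' (all such relations valid in G, y,y',z in Y):
  the congruence on words generated by free cancellation and these relations.\<close>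

inductive pres_eq :: "('g, 'b) monoid_scheme \<Rightarrow> 'g set \<Rightarrow> ('g \<times> bool) list \<Rightarrow> ('g \<times> bool) list \<Rightarrow> bool"
  for G Y where
  pres_refl: "Y_letters Y w \<Longrightarrow> pres_eq G Y w w"
| pres_sym: "pres_eq G Y v w \<Longrightarrow> pres_eq G Y w v"
| pres_trans: "pres_eq G Y u v \<Longrightarrow> pres_eq G Y v w \<Longrightarrow> pres_eq G Y u w"
| pres_free: "y \<in> Y \<Longrightarrow> pres_eq G Y [(y, b), (y, \<not> b)] []"
| pres_rel: "y \<in> Y \<Longrightarrow> z \<in> Y \<Longrightarrow> y' \<in> Y \<Longrightarrow> inv\<^bsub>G\<^esub> z \<otimes>\<^bsub>G\<^esub> y \<otimes>\<^bsub>G\<^esub> z = y'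
     \<Longrightarrow> pres_eq G Y [(z, False), (y, True), (z, True)] [(y', True)]"
| pres_cong: "pres_eq G Y v v' \<Longrightarrow> Y_letters Y u \<Longrightarrow> Y_letters Y w
     \<Longrightarrow> pres_eq G Y (u @ v @ w) (u @ v' @ w)"

definition conj_closed :: "('g, 'b) monoid_scheme \<Rightarrow> 'g set \<Rightarrow> bool" where
  "conj_closed G Y \<longleftrightarrow> (\<forall>y\<in>Y. \<forall>g\<in>carrier G. inv\<^bsub>G\<^esub> g \<otimes>\<^bsub>G\<^esub> y \<otimes>\<^bsub>G\<^esub> g \<in> Y)"

definition conj_class :: "('g, 'b) monoid_scheme \<Rightarrow> 'g \<Rightarrow> 'g set" where
  "conj_class G y = {inv\<^bsub>G\<^esub> g \<otimes>\<^bsub>G\<^esub> y \<otimes>\<^bsub>G\<^esub> g | g. g \<in> carrier G}"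

definition equipped_group :: "('g, 'b) monoid_scheme \<Rightarrow> 'g set \<Rightarrow> bool" where
  "equipped_group G Y \<longleftrightarrow> group G \<and> Y \<subseteq> carrier G \<and> \<one>\<^bsub>G\<^esub> \<notin> Y \<and> conj_closed G Y
     \<and> finite (conj_class G ` Y)"

text \<open>C-group: the evaluation map from words over Y to G is surjective and its kernel is
  exactly given by the conjugation relations, i.e. G = <Y | z^-1 y z = y'>.\<close>
definition C_group :: "('g, 'b) monoid_scheme \<Rightarrow> 'g set \<Rightarrow> bool" where
  "C_group G Y \<longleftrightarrow> equipped_group G Y
     \<and> (\<forall>g\<in>carrier G. \<exists>w. Y_letters Y w \<and> word_eval G w = g)
     \<and> (\<forall>w1 w2. Y_letters Y w1 \<longrightarrow> Y_letters Y w2 \<longrightarrow> word_eval G w1 = word_eval G w2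
            \<longrightarrow> pres_eq G Y w1 w2)"

definition finite_C_group :: "('g, 'b) monoid_scheme \<Rightarrow> 'g set \<Rightarrow> bool" where
  "finite_C_group G Y \<longleftrightarrow> C_group G Y \<and> finite Y"

text \<open>Elements of S(G,Y) are represented by words (lists) over Y; the empty word is the
  identity. fs_eq is the congruence generated by the defining relations, so
  fs_eq G Y u v means that u and v represent the same element of S(G,Y).\<close>

definition fs_word :: "'g set \<Rightarrow> 'g list \<Rightarrow> bool" where
  "fs_word Y s \<longleftrightarrow> set s \<subseteq> Y"

inductive fs_eq :: "('g, 'b) monoid_scheme \<Rightarrow> 'g set \<Rightarrow> 'g list \<Rightarrow> 'g list \<Rightarrow> bool"
  for G Y where
  fs_refl: "fs_word Y w \<Longrightarrow> fs_eq G Y w w"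
| fs_sym: "fs_eq G Y v w \<Longrightarrow> fs_eq G Y w v"
| fs_trans: "fs_eq G Y u v \<Longrightarrow> fs_eq G Y v w \<Longrightarrow> fs_eq G Y u w"
| fs_rel1: "g1 \<in> Y \<Longrightarrow> g2 \<in> Y \<Longrightarrow>
     fs_eq G Y [g1, g2] [g2, inv\<^bsub>G\<^esub> g2 \<otimes>\<^bsub>G\<^esub> g1 \<otimes>\<^bsub>G\<^esub> g2]"
| fs_rel2: "g1 \<in> Y \<Longrightarrow> g2 \<in> Y \<Longrightarrow>
     fs_eq G Y [g1, g2] [g1 \<otimes>\<^bsub>G\<^esub> g2 \<otimes>\<^bsub>G\<^esub> inv\<^bsub>G\<^esub> g1, g1]"
| fs_cong: "fs_eq G Y v v' \<Longrightarrow> fs_word Y u \<Longrightarrow> fs_word Y w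
     \<Longrightarrow> fs_eq G Y (u @ v @ w) (u @ v' @ w)"

definition fs_alpha :: "('g, 'b) monoid_scheme \<Rightarrow> 'g list \<Rightarrow> 'g" where
  "fs_alpha G s = foldr (\<lambda>y acc. y \<otimes>\<^bsub>G\<^esub> acc) s \<one>\<^bsub>G\<^esub>"

definition class_enumeration :: "('g, 'b) monoid_scheme \<Rightarrow> 'g set \<Rightarrow> 'g list list \<Rightarrow> bool" where
  "class_enumeration G Y cls \<longleftrightarrow> distinct (concat cls) \<and> set (concat cls) = Y
     \<and> (\<forall>c\<in>set cls. c \<noteq> [] \<and> set c = conj_class G (hd c))"

definition fs_type :: "'g list list \<Rightarrow> 'g list \<Rightarrow> nat list" where
  "fs_type cls s = map (\<lambda>c. length (filter (\<lambda>y. y \<in> set c) s)) cls"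

definition central_exp :: "('g, 'b) monoid_scheme \<Rightarrow> 'g \<Rightarrow> nat" where
  "central_exp G y = (LEAST p. 1 \<le> p \<and>
      (\<forall>g\<in>carrier G. g \<otimes>\<^bsub>G\<^esub> (y [^]\<^bsub>G\<^esub> p) = (y [^]\<^bsub>G\<^esub> p) \<otimes>\<^bsub>G\<^esub> g))"

definition ordered_prod :: "'g list list \<Rightarrow> ('g \<Rightarrow> nat) \<Rightarrow> 'g list" where
  "ordered_prod cls k = concat (map (\<lambda>c. concat (map (\<lambda>y. replicate (k y) y) c)) cls)"

definition s_Gamma :: "('g, 'b) monoid_scheme \<Rightarrow> 'g list list \<Rightarrow> 'g list" where
  "s_Gamma G cls = ordered_prod cls (central_exp G)"

definition fs_pow :: "'g list \<Rightarrow> nat \<Rightarrow> 'g list" where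
  "fs_pow s n = concat (replicate n s)"

definition fs_equiv :: "('g, 'b) monoid_scheme \<Rightarrow> 'g set \<Rightarrow> 'g list \<Rightarrow> 'g list \<Rightarrow> bool" where
  "fs_equiv G Y s1 s2 \<longleftrightarrow> (\<exists>s3 s4. fs_word Y s3 \<and> fs_word Y s4 \<and>
      fs_eq G Y (s3 @ s1 @ s4) (s3 @ s2 @ s4))"

definition e_fun :: "('g, 'b) monoid_scheme \<Rightarrow> 'g set \<Rightarrow> 'g list \<Rightarrow> 'g list \<Rightarrow> nat" where
  "e_fun G Y s1 s2 = (LEAST n. \<exists>s. fs_word Y s \<and> length s = n \<and> fs_eq G Y (s1 @ s) (s2 @ s))"

definition R_set :: "('g, 'b) monoid_scheme \<Rightarrow> 'g list list \<Rightarrow> 'g list set" where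
  "R_set G cls = {ordered_prod cls k | k.
      \<forall>c\<in>set cls. sum_list (map k c) \<le> central_exp G (hd c) * length c}"

definition E_set :: "('g, 'b) monoid_scheme \<Rightarrow> 'g set \<Rightarrow> 'g list list \<Rightarrow> ('g list \<times> 'g list) set" where
  "E_set G Y cls = {(s1, s2). s1 \<in> R_set G cls \<and> s2 \<in> R_set G cls \<and> fs_equiv G Y s1 s2}"

definition e_Gamma :: "('g, 'b) monoid_scheme \<Rightarrow> 'g set \<Rightarrow> 'g list list \<Rightarrow> nat" where
  "e_Gamma G Y cls = Max ((\<lambda>(s1, s2). e_fun G Y s1 s2) ` E_set G Y cls)"

definition stabilizing :: "('g, 'b) monoid_scheme \<Rightarrow> 'g set \<Rightarrow> 'g list list \<Rightarrow> 'g list \<Rightarrow> bool" where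
  "stabilizing G Y cls s \<longleftrightarrow> fs_word Y s \<and> (\<forall>s1 s2. fs_word Y s1 \<longrightarrow> fs_word Y s2 \<longrightarrow>
      fs_alpha G s1 = fs_alpha G s2 \<longrightarrow> fs_type cls s1 = fs_type cls s2 \<longrightarrow>
      fs_eq G Y (s1 @ s) (s2 @ s))"

definition fs_stable :: "('g, 'b) monoid_scheme \<Rightarrow> 'g set \<Rightarrow> 'g list list \<Rightarrow> bool" where
  "fs_stable G Y cls \<longleftrightarrow> (\<exists>s. stabilizing G Y cls s)"

end

theory Submission
  imports Defs
begin

text \<open>For \<open>y \<in> Y\<close> put \<open>z\<^sub>y = x\<^sub>y\<^sup>p\<close>, where \<open>p\<close> is the least exponent making \<open>y\<^sup>p\<close> central
  in \<open>G\<close>.  Then \<open>z\<^sub>y\<close> is central in the semigroup, and commuting it with \<open>x\<^sub>a\<close> in two ways gives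
  \<open>z\<^sub>y x\<^sub>a = z\<^sub>b x\<^sub>a\<close> with \<open>b = a\<^sup>-\<^sup>1 y a\<close>.  Since \<open>s\<^sub>\<Gamma>\<close> is central and divisible by every generator,
  \<open>z\<^sub>y s\<^sub>\<Gamma>\<close> depends only on the conjugacy class of \<open>y\<close>.  Inverting the elements \<open>z\<^sub>y\<close> turns the
  semigroup into the group \<open>G\<close>, by the presentation of \<open>G\<close>; hence two elements of equal product and
  type become equal after multiplication by some element.  Finally every element has an ordered normal
  form.  Two normal forms of equal type outside \<open>R\<close> both contain, by pigeonhole, factors
  \<open>z\<^sub>y\<close> and \<open>z\<^sub>b\<close> from the same class, and these can be split off.  So everything
  reduces to pairs in \<open>R\<close>, and an element of length at most \<open>e\<close> divides \<open>s\<^sub>\<Gamma>\<^sup>e\<close>.\<close>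

section \<open>Ordered products of powers\<close>

definition blocks :: "('a \<Rightarrow> nat) \<Rightarrow> 'a list \<Rightarrow> 'a list" where
  "blocks k ys = concat (map (\<lambda>y. replicate (k y) y) ys)"

lemma blocks_simps [simp]:
  "blocks k [] = []"
  "blocks k (y # ys) = replicate (k y) y @ blocks k ys"
  "blocks k (ys @ zs) = blocks k ys @ blocks k zs"
  by (simp_all add: blocks_def)

lemma set_blocks: "set (blocks k ys) \<subseteq> set ys"
  by (auto simp: blocks_def)

lemma blocks_cong: "(\<And>y. y \<in> set ys \<Longrightarrow> k y = l y) \<Longrightarrow> blocks k ys = blocks l ys"
  by (induction ys) auto

text \<open>The partition into classes only matters for counting; on the flat list
  \<open>concat cls\<close>, whose entries are distinct, a product can be cut open at any single
  letter.\<close>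

lemma ordered_prod_eq_blocks: "ordered_prod cls k = blocks k (concat cls)"
  by (induction cls) (simp_all add: ordered_prod_def blocks_def)

lemma filter_replicate_in: "filter P (replicate n y) = (if P y then replicate n y else [])"
  by (induction n) auto

section \<open>Conjugation and central powers in a group\<close>

context group
begin

definition power_central :: "'a \<Rightarrow> nat \<Rightarrow> bool" where
  "power_central y p \<longleftrightarrow> (\<forall>g\<in>carrier G. g \<otimes> y [^] p = y [^] p \<otimes> g)"

lemma conj_mult:
  assumes "x \<in> carrier G" "y \<in> carrier G" "g \<in> carrier G"
  shows "inv g \<otimes> (x \<otimes> y) \<otimes> g = (inv g \<otimes> x \<otimes> g) \<otimes> (inv g \<otimes> y \<otimes> g)"
proof -
  have "g \<otimes> (inv g \<otimes> (y \<otimes> g)) = y \<otimes> g"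
    using assms by (simp add: m_assoc[symmetric])
  then show ?thesis using assms by (simp add: m_assoc)
qed

lemma conj_pow:
  assumes "y \<in> carrier G" "g \<in> carrier G"
  shows "(inv g \<otimes> y \<otimes> g) [^] (n::nat) = inv g \<otimes> y [^] n \<otimes> g"
  by (induction n) (use assms in \<open>simp_all add: conj_mult\<close>)

lemma conj_conj:
  assumes "y \<in> carrier G" "g \<in> carrier G" "h \<in> carrier G"
  shows "inv h \<otimes> (inv g \<otimes> y \<otimes> g) \<otimes> h = inv (g \<otimes> h) \<otimes> y \<otimes> (g \<otimes> h)"
  using assms by (simp add: inv_mult_group m_assoc)

lemma conj_conj_inv:
  assumes "y \<in> carrier G" "g \<in> carrier G"
  shows "inv g \<otimes> (g \<otimes> y \<otimes> inv g) \<otimes> g = y"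
  using conj_conj[of y "inv g" g] assms by simp

lemma conj_central:
  assumes "y \<in> carrier G" "g \<in> carrier G" "g \<otimes> y = y \<otimes> g"
  shows "inv g \<otimes> y \<otimes> g = y"
proof -
  have "inv g \<otimes> y \<otimes> g = inv g \<otimes> (g \<otimes> y)"
    unfolding assms(3) using assms(1,2) by (simp add: m_assoc)
  also have "\<dots> = y" using assms(1,2) by (simp add: m_assoc[symmetric])
  finally show ?thesis .
qed

lemma commute_of_conj_fixed:
  assumes "y \<in> carrier G" "g \<in> carrier G" "inv g \<otimes> y \<otimes> g = y"
  shows "g \<otimes> y = y \<otimes> g"
proof -
  have "g \<otimes> (inv g \<otimes> y \<otimes> g) = y \<otimes> g"
    using assms(1,2) by (simp add: m_assoc[symmetric])
  then show ?thesis unfolding assms(3) .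
qed

text \<open>Conjugation fixes the central element y^p, so the p-th power of the conjugate is y^p
  itself.\<close>

lemma power_central_conj:
  assumes "y \<in> carrier G" "g \<in> carrier G" "power_central y p"
  shows "power_central (inv g \<otimes> y \<otimes> g) p"
proof -
  have "(inv g \<otimes> y \<otimes> g) [^] p = y [^] p"
    using assms conj_central[of "y [^] p" g] by (simp add: conj_pow power_central_def)
  then show ?thesis using assms by (simp add: power_central_def)
qed

lemma central_exp_conj:
  assumes "y \<in> carrier G" "g \<in> carrier G"
  shows "central_exp G (inv g \<otimes> y \<otimes> g) = central_exp G y"
proof -
  have "power_central (inv g \<otimes> y \<otimes> g) p \<longleftrightarrow> power_central y p" for p
    using power_central_conj[of y g p] power_central_conj[of "inv g \<otimes> y \<otimes> g" "inv g" p]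
      conj_conj[of y g "inv g"] assms by auto
  then show ?thesis by (simp add: central_exp_def power_central_def)
qed

end

section \<open>Finite C-groups and their conjugacy classes\<close>

locale enumerated_finite_C_group =
  fixes G (structure) and Y and cls
  assumes finite_C: "finite_C_group G Y"
    and enum: "class_enumeration G Y cls"
begin

sublocale group G
  using finite_C by (simp add: finite_C_group_def C_group_def equipped_group_def)

abbreviation fs_eq_notation (infix "\<approx>" 50) where "u \<approx> v \<equiv> fs_eq G Y u v"

abbreviation p where "p \<equiv> central_exp G"

lemma fin_Y: "finite Y"
  and Y_carrier: "y \<in> Y \<Longrightarrow> y \<in> carrier G"
  and Y_conj: "y \<in> Y \<Longrightarrow> g \<in> carrier G \<Longrightarrow> inv g \<otimes> y \<otimes> g \<in> Y"
  using finite_C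
  by (auto simp: finite_C_group_def C_group_def equipped_group_def conj_closed_def)

lemma Y_conj': "y \<in> Y \<Longrightarrow> g \<in> carrier G \<Longrightarrow> g \<otimes> y \<otimes> inv g \<in> Y"
  using Y_conj[of y "inv g"] by simp

lemma generated: "g \<in> carrier G \<Longrightarrow> \<exists>w. Y_letters Y w \<and> word_eval G w = g"
  and presented: "\<lbrakk>Y_letters Y v; Y_letters Y w; word_eval G v = word_eval G w\<rbrakk> \<Longrightarrow> pres_eq G Y v w"
  using finite_C by (simp_all add: finite_C_group_def C_group_def)

lemma distinct_enum: "distinct (concat cls)"
  and set_enum: "set (concat cls) = Y"
  and class_eq: "c \<in> set cls \<Longrightarrow> set c = conj_class G (hd c)"
  and class_nonempty: "c \<in> set cls \<Longrightarrow> c \<noteq> []"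
  using enum by (auto simp: class_enumeration_def)

lemma class_subset: "c \<in> set cls \<Longrightarrow> set c \<subseteq> Y"
  using set_enum by auto

lemma class_rep: "c \<in> set cls \<Longrightarrow> hd c \<in> Y"
  using class_subset class_nonempty by fastforce

lemma class_mem:
  assumes "c \<in> set cls" "y \<in> set c"
  obtains g where "g \<in> carrier G" "y = inv g \<otimes> hd c \<otimes> g"
  using assms class_eq[OF assms(1)] by (auto simp: conj_class_def)

lemma class_conj:
  assumes "c \<in> set cls" "y \<in> set c" "g \<in> carrier G"
  shows "inv g \<otimes> y \<otimes> g \<in> set c"
proof -
  obtain h where h: "h \<in> carrier G" "y = inv h \<otimes> hd c \<otimes> h" using class_mem assms by blast
  have "inv g \<otimes> y \<otimes> g = inv (h \<otimes> g) \<otimes> hd c \<otimes> (h \<otimes> g)"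
    unfolding h(2) by (intro conj_conj) (use h assms class_rep Y_carrier in auto)
  then show ?thesis
    using h(1) assms(3) unfolding class_eq[OF assms(1)] conj_class_def by blast
qed

lemma class_conj_iff:
  assumes "c \<in> set cls" "y \<in> Y" "g \<in> carrier G"
  shows "inv g \<otimes> y \<otimes> g \<in> set c \<longleftrightarrow> y \<in> set c"
  using class_conj[OF assms(1), of y g] class_conj[OF assms(1), of "inv g \<otimes> y \<otimes> g" "inv g"]
    conj_conj[of y g "inv g"] assms Y_carrier by auto

lemma class_conjugate:
  assumes "c \<in> set cls" "x \<in> set c" "y \<in> set c"
  obtains g where "g \<in> carrier G" "y = inv g \<otimes> x \<otimes> g"
proof -
  obtain h where h: "h \<in> carrier G" "x = inv h \<otimes> hd c \<otimes> h" using class_mem assms by blast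
  obtain k where k: "k \<in> carrier G" "y = inv k \<otimes> hd c \<otimes> k" using class_mem assms by blast
  have hd: "hd c \<in> carrier G" using class_rep assms Y_carrier by blast
  have "inv (inv h \<otimes> k) \<otimes> x \<otimes> (inv h \<otimes> k) = inv (h \<otimes> (inv h \<otimes> k)) \<otimes> hd c \<otimes> (h \<otimes> (inv h \<otimes> k))"
    unfolding h(2) by (intro conj_conj) (use h k hd in auto)
  also have "h \<otimes> (inv h \<otimes> k) = k" using h k by (simp add: m_assoc[symmetric])
  finally show ?thesis using that[of "inv h \<otimes> k"] h k by simp
qed

lemma p_class:
  assumes "c \<in> set cls" "y \<in> set c"
  shows "p y = p (hd c)"
  using class_mem[OF assms] central_exp_conj[of "hd c"] class_rep[OF assms(1)] Y_carrier by metis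

lemma word_eval_Cons: "word_eval G (l # w) = letter_val G l \<otimes> word_eval G w"
  by (simp add: word_eval_def)

lemma letter_val_closed: "fst l \<in> Y \<Longrightarrow> letter_val G l \<in> carrier G"
  by (simp add: letter_val_def Y_carrier)

lemma word_eval_closed: "Y_letters Y w \<Longrightarrow> word_eval G w \<in> carrier G"
  by (induction w) (auto simp: word_eval_Cons Y_letters_def letter_val_closed, simp add: word_eval_def)

text \<open>Induction on a word spelling g. It extends facts about single generators to all of
  G.\<close>

lemma generated_induct [consumes 1, case_names one gen gen_inv]:
  assumes "g \<in> carrier G"
    and "P \<one>"
    and "\<And>y g. y \<in> Y \<Longrightarrow> g \<in> carrier G \<Longrightarrow> P g \<Longrightarrow> P (y \<otimes> g)"
    and "\<And>y g. y \<in> Y \<Longrightarrow> g \<in> carrier G \<Longrightarrow> P g \<Longrightarrow> P (inv y \<otimes> g)"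
  shows "P g"
proof -
  have "Y_letters Y w \<Longrightarrow> P (word_eval G w)" for w
  proof (induction w)
    case Nil
    then show ?case using assms(2) by (simp add: word_eval_def)
  next
    case (Cons l w)
    then show ?case
      using assms(3,4) word_eval_closed[of w]
      by (auto simp: word_eval_Cons letter_val_def Y_letters_def)
  qed
  then show ?thesis using generated[OF assms(1)] by blast
qed

text \<open>The powers of y act on the finite set Y by conjugation, so two of them act alike. Their
  quotient y^d commutes with every element of Y, hence with G, which Y generates. This makes the
  LEAST in \<open>central_exp\<close> meaningful.\<close>

lemma ex_power_central:
  assumes y: "y \<in> Y"
  shows "\<exists>n\<ge>1. power_central y n"
proof -
  \<comment> \<open>Restricting the action to Y places all these maps in the finite set
    \<open>Y \<rightarrow>\<^sub>E Y\<close>.\<close>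
  let ?f = "\<lambda>n::nat. \<lambda>a\<in>Y. inv (y [^] n) \<otimes> a \<otimes> y [^] n"
  have yc: "y \<in> carrier G" using y Y_carrier by blast
  have "range ?f \<subseteq> Y \<rightarrow>\<^sub>E Y" using Y_conj yc by auto
  moreover have "finite (Y \<rightarrow>\<^sub>E Y)" using fin_Y by (simp add: finite_PiE)
  ultimately have "finite (range ?f)" using finite_subset by blast
  then have "\<not> inj ?f" using finite_imageD infinite_UNIV_nat by blast
  then obtain m n where mn: "m < n" "?f m = ?f n"
    unfolding inj_def by (metis linorder_neqE_nat)
  define d where "d = n - m"
  have n: "n = d + m" using mn by (simp add: d_def)
  have fixed: "a \<otimes> y [^] d = y [^] d \<otimes> a" if a: "a \<in> Y" for a
  proof -
    have ac: "a \<in> carrier G" using a Y_carrier by blast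
    let ?b = "inv (y [^] d) \<otimes> a \<otimes> y [^] d"
    have "inv (y [^] m) \<otimes> a \<otimes> y [^] m = inv (y [^] n) \<otimes> a \<otimes> y [^] n"
      using fun_cong[OF mn(2), of a] a by simp
    \<comment> \<open>Conjugation by y^n is conjugation by y^d followed by the injective conjugation
      by y^m, which can be cancelled.\<close>
    also have "\<dots> = inv (y [^] m) \<otimes> ?b \<otimes> y [^] m"
      unfolding n using conj_conj[of a "y [^] d" "y [^] m"] ac yc by (simp add: nat_pow_mult)
    finally have "a = ?b" using ac yc by simp
    then show ?thesis using commute_of_conj_fixed[of a "y [^] d"] ac yc by simp
  qed
  have "power_central y d"
    unfolding power_central_def
  proof
    fix g assume "g \<in> carrier G"
    then show "g \<otimes> y [^] d = y [^] d \<otimes> g"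
    proof (induction rule: generated_induct)
      case one
      then show ?case using yc by simp
    next
      case (gen a g)
      then show ?case using fixed[of a] yc Y_carrier[of a]
        by (metis m_assoc nat_pow_closed)
    next
      case (gen_inv a g)
      have ac: "a \<in> carrier G" using gen_inv Y_carrier by blast
      have "inv a \<otimes> y [^] d = y [^] d \<otimes> inv a"
        using fixed[OF gen_inv(1)] ac yc by (metis inv_solve_left inv_solve_right m_closed nat_pow_closed inv_closed m_assoc)
      then show ?case using gen_inv ac yc by (metis m_assoc nat_pow_closed inv_closed)
    qed
  qed
  then show ?thesis using mn(1) by (intro exI[of _ d]) (simp add: d_def)
qed

lemma p_pos: "y \<in> Y \<Longrightarrow> 1 \<le> p y"
  and p_central: "y \<in> Y \<Longrightarrow> power_central y (p y)"
proof -
  assume "y \<in> Y"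
  then have "\<exists>n::nat. 1 \<le> n \<and> (\<forall>g\<in>carrier G. g \<otimes> y [^] n = y [^] n \<otimes> g)"
    using ex_power_central unfolding power_central_def by blast
  then have "1 \<le> p y \<and> (\<forall>g\<in>carrier G. g \<otimes> y [^] p y = y [^] p y \<otimes> g)"
    unfolding central_exp_def by (rule LeastI_ex)
  then show "1 \<le> p y" "power_central y (p y)" by (auto simp: power_central_def)
qed

subsection \<open>The congruence of the factorization semigroup\<close>

declare fs_trans [trans]

lemma fs_word_simps [simp]:
  "fs_word Y []"
  "fs_word Y (y # u) \<longleftrightarrow> y \<in> Y \<and> fs_word Y u"
  "fs_word Y (u @ v) \<longleftrightarrow> fs_word Y u \<and> fs_word Y v"
  "fs_word Y (replicate n y) \<longleftrightarrow> n = 0 \<or> y \<in> Y"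
  by (auto simp: fs_word_def)

lemma fs_word_blocks: "set ys \<subseteq> Y \<Longrightarrow> fs_word Y (blocks k ys)"
  using set_blocks[of k ys] by (auto simp: fs_word_def)

lemma fs_eq_word: "u \<approx> v \<Longrightarrow> fs_word Y u \<and> fs_word Y v"
  by (induction rule: fs_eq.induct) (auto simp: Y_conj Y_conj' Y_carrier)

lemma fs_eq_append:
  assumes "u \<approx> u'" "v \<approx> v'"
  shows "u @ v \<approx> u' @ v'"
proof -
  have "[] @ u @ v \<approx> [] @ u' @ v"
    using fs_eq_word[OF assms(2)] by (intro fs_cong assms) auto
  also have "[] @ u' @ v = u' @ v @ []" by simp
  also have "u' @ v @ [] \<approx> u' @ v' @ []"
    using fs_eq_word[OF assms(1)] by (intro fs_cong assms) auto
  finally show ?thesis by simp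
qed

lemma fs_eq_append_left: "fs_word Y u \<Longrightarrow> v \<approx> v' \<Longrightarrow> u @ v \<approx> u @ v'"
  by (intro fs_eq_append fs_refl)

lemma fs_eq_append_right: "fs_word Y v \<Longrightarrow> u \<approx> u' \<Longrightarrow> u @ v \<approx> u' @ v"
  by (intro fs_eq_append fs_refl)

lemma fs_eq_length: "u \<approx> v \<Longrightarrow> length u = length v"
  by (induction rule: fs_eq.induct) auto

lemma fs_alpha_simps [simp]:
  "fs_alpha G [] = \<one>"
  "fs_alpha G (y # u) = y \<otimes> fs_alpha G u"
  by (simp_all add: fs_alpha_def)

lemma fs_alpha_closed [simp]: "fs_word Y u \<Longrightarrow> fs_alpha G u \<in> carrier G"
  by (induction u) (auto simp: Y_carrier)

lemma fs_alpha_append [simp]: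
  "fs_word Y u \<Longrightarrow> fs_word Y v \<Longrightarrow> fs_alpha G (u @ v) = fs_alpha G u \<otimes> fs_alpha G v"
  by (induction u) (auto simp: Y_carrier m_assoc)

lemma fs_alpha_replicate: "y \<in> Y \<Longrightarrow> fs_alpha G (replicate n y) = y [^] n"
  by (induction n) (simp_all add: Y_carrier nat_pow_Suc2 del: nat_pow_Suc Group.nat_pow_Suc)

lemma fs_eq_alpha: "u \<approx> v \<Longrightarrow> fs_alpha G u = fs_alpha G v"
proof (induction rule: fs_eq.induct)
  case (fs_rel1 a b)
  then have "b \<otimes> (inv b \<otimes> a \<otimes> b) = a \<otimes> b"
    by (simp add: Y_carrier m_assoc[symmetric])
  then show ?case using fs_rel1 by (simp add: Y_carrier)
next
  case (fs_rel2 a b)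
  then have "(a \<otimes> b \<otimes> inv a) \<otimes> a = a \<otimes> b"
    by (simp add: Y_carrier m_assoc)
  then show ?case using fs_rel2 by (simp add: Y_carrier)
next
  case (fs_cong v v' u w)
  then show ?case using fs_eq_word[OF fs_cong(1)] by simp
qed auto

text \<open>One coordinate of \<open>fs_type\<close>; working coordinatewise makes the type additive
  under append.\<close>

definition class_count :: "'a list \<Rightarrow> 'a list \<Rightarrow> nat" where
  "class_count c s = length (filter (\<lambda>y. y \<in> set c) s)"

lemma class_count_simps [simp]:
  "class_count c [] = 0"
  "class_count c (y # s) = (if y \<in> set c then Suc (class_count c s) else class_count c s)"
  "class_count c (s @ t) = class_count c s + class_count c t"
  "class_count c (replicate n y) = (if y \<in> set c then n else 0)"
  by (simp_all add: class_count_def filter_replicate_in)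

lemma fs_type_eq_iff:
  "fs_type cls s = fs_type cls t \<longleftrightarrow> (\<forall>c\<in>set cls. class_count c s = class_count c t)"
  by (simp add: fs_type_def class_count_def)

lemma fs_eq_class_count:
  assumes "c \<in> set cls" "u \<approx> v"
  shows "class_count c u = class_count c v"
  using assms(2)
proof (induction rule: fs_eq.induct)
  case (fs_rel1 a b)
  then show ?case using class_conj_iff[OF assms(1), of a b] by (auto simp: Y_carrier)
next
  case (fs_rel2 a b)
  then show ?case using class_conj_iff[OF assms(1), of b "inv a"] by (auto simp: Y_carrier)
qed auto

lemma class_count_blocks_outside:
  "set c \<inter> set ys = {} \<Longrightarrow> class_count c (blocks k ys) = 0"
  by (induction ys) auto

lemma class_count_blocks_inside:
  "set ys \<subseteq> set c \<Longrightarrow> class_count c (blocks k ys) = sum_list (map k ys)"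
  by (induction ys) auto

lemma class_count_ordered_prod:
  assumes "c \<in> set cls"
  shows "class_count c (ordered_prod cls k) = sum_list (map k c)"
proof -
  obtain A B where AB: "cls = A @ c # B" using assms by (meson split_list)
  have "set c \<inter> set (concat A) = {}" "set c \<inter> set (concat B) = {}"
    using distinct_enum unfolding AB by auto
  then show ?thesis
    unfolding ordered_prod_eq_blocks AB
    by (simp add: class_count_blocks_outside class_count_blocks_inside)
qed

text \<open>Each use of the first relation carries y past one letter and conjugates that letter,
  while y itself is unchanged.\<close>

lemma word_move_left:
  assumes "fs_word Y u" "y \<in> Y"
  shows "u @ [y] \<approx> y # map (\<lambda>x. inv y \<otimes> x \<otimes> y) u"
  using assms(1)
proof (induction u)
  case Nil
  then show ?case using assms by (simp add: fs_refl)
next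
  case (Cons x u)
  let ?u = "map (\<lambda>x. inv y \<otimes> x \<otimes> y) u"
  have u: "fs_word Y ?u" using Cons.prems assms(2) by (auto simp: fs_word_def Y_conj Y_carrier)
  have "[x] @ (u @ [y]) \<approx> [x] @ (y # ?u)"
    using Cons by (intro fs_eq_append_left) auto
  also have "[x] @ (y # ?u) = [x, y] @ ?u" by simp
  also have "\<dots> \<approx> [y, inv y \<otimes> x \<otimes> y] @ ?u"
    using Cons.prems assms(2) u by (intro fs_eq_append_right fs_rel1) auto
  finally show ?case by simp
qed

text \<open>Here the travelling letter absorbs the conjugations, one per letter passed, and these
  compose to conjugation by the product of u.\<close>

lemma letter_move_right:
  assumes "x \<in> Y" "fs_word Y u"
  shows "x # u \<approx> u @ [inv (fs_alpha G u) \<otimes> x \<otimes> fs_alpha G u]"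
  using assms
proof (induction u arbitrary: x)
  case Nil
  then show ?case by (simp add: fs_refl Y_carrier)
next
  case (Cons y u)
  let ?x = "inv y \<otimes> x \<otimes> y"
  have x: "?x \<in> Y" using Cons.prems by (simp add: Y_conj Y_carrier)
  have "[x, y] @ u \<approx> [y, ?x] @ u"
    using Cons.prems by (intro fs_eq_append_right fs_rel1) auto
  also have "[y, ?x] @ u = [y] @ (?x # u)" by simp
  also have "\<dots> \<approx> [y] @ (u @ [inv (fs_alpha G u) \<otimes> ?x \<otimes> fs_alpha G u])"
    using Cons.prems by (intro fs_eq_append_left Cons.IH x) auto
  also have "inv (fs_alpha G u) \<otimes> ?x \<otimes> fs_alpha G u
      = inv (fs_alpha G (y # u)) \<otimes> x \<otimes> fs_alpha G (y # u)"
    using Cons.prems by (simp add: conj_conj Y_carrier)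
  finally show ?case by simp
qed

subsection \<open>Central elements\<close>

definition central_word :: "'a list \<Rightarrow> bool" where
  "central_word z \<longleftrightarrow> fs_word Y z \<and> (\<forall>w. fs_word Y w \<longrightarrow> w @ z \<approx> z @ w)"

lemma central_word_is_word: "central_word z \<Longrightarrow> fs_word Y z"
  and central_word_commute: "central_word z \<Longrightarrow> fs_word Y w \<Longrightarrow> w @ z \<approx> z @ w"
  by (auto simp: central_word_def)

lemma central_word_letters:
  assumes z: "fs_word Y z" and letters: "\<And>x. x \<in> Y \<Longrightarrow> x # z \<approx> z @ [x]"
  shows "central_word z"
proof -
  have "w @ z \<approx> z @ w" if "fs_word Y w" for w
    using that
  proof (induction w)
    case Nil
    then show ?case using z by (simp add: fs_refl)
  next
    case (Cons x w)
    have "[x] @ (w @ z) \<approx> [x] @ (z @ w)" using Cons by (intro fs_eq_append_left) auto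
    also have "[x] @ (z @ w) = (x # z) @ w" by simp
    also have "\<dots> \<approx> (z @ [x]) @ w" using Cons by (intro fs_eq_append_right letters) auto
    finally show ?case by simp
  qed
  then show ?thesis using z by (simp add: central_word_def)
qed

lemma central_word_append:
  assumes "central_word u" "central_word v"
  shows "central_word (u @ v)"
  unfolding central_word_def
proof (intro conjI allI impI)
  show "fs_word Y (u @ v)" using assms by (simp add: central_word_def)
  fix w assume w: "fs_word Y w"
  have "(w @ u) @ v \<approx> (u @ w) @ v"
    using assms w by (intro fs_eq_append_right central_word_commute) (auto intro: central_word_is_word)
  also have "(u @ w) @ v = u @ (w @ v)" by simp
  also have "\<dots> \<approx> u @ (v @ w)"
    using assms w by (intro fs_eq_append_left central_word_commute) (auto intro: central_word_is_word)
  finally show "w @ (u @ v) \<approx> (u @ v) @ w" by simp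
qed

lemma central_word_Nil: "central_word []"
  by (simp add: central_word_def fs_refl)

text \<open>A letter moved across this word is conjugated by y^p, which is central in G, so it
  arrives unchanged.\<close>

lemma central_word_power: "y \<in> Y \<Longrightarrow> central_word (replicate (p y) y)"
proof (intro central_word_letters)
  fix x assume y: "y \<in> Y" and x: "x \<in> Y"
  have c: "y [^] p y \<in> carrier G" "x \<in> carrier G" using x y by (auto simp: Y_carrier)
  have comm: "x \<otimes> y [^] p y = y [^] p y \<otimes> x"
    using p_central[OF y] c by (simp add: power_central_def)
  have "inv (y [^] p y) \<otimes> x \<otimes> y [^] p y = x"
    using comm c by (intro conj_central) auto
  then show "x # replicate (p y) y \<approx> replicate (p y) y @ [x]"
    using letter_move_right[OF x, of "replicate (p y) y"] y by (simp add: fs_alpha_replicate)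
qed simp

lemma central_word_blocks: "set ys \<subseteq> Y \<Longrightarrow> central_word (blocks p ys)"
  by (induction ys) (auto intro: central_word_Nil central_word_append central_word_power)

section \<open>The canonical element: centrality and divisibility\<close>

abbreviation sG where "sG \<equiv> s_Gamma G cls"

lemma sG_eq: "sG = blocks p (concat cls)"
  by (simp add: s_Gamma_def ordered_prod_eq_blocks)

lemma central_sG: "central_word sG"
  unfolding sG_eq using set_enum by (intro central_word_blocks) simp

lemma word_sG: "fs_word Y sG"
  using central_sG central_word_is_word by blast

lemma fs_pow_simps [simp]: "fs_pow s 0 = []" "fs_pow s (Suc n) = s @ fs_pow s n"
  by (simp_all add: fs_pow_def)

lemma fs_pow_add: "fs_pow s (m + n) = fs_pow s m @ fs_pow s n"
  by (induction m) auto

lemma central_fs_pow: "central_word s \<Longrightarrow> central_word (fs_pow s n)"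
  by (induction n) (auto intro: central_word_Nil central_word_append)

text \<open>The block of x is nonempty because its exponent is at least 1, and it is central, so it
  can be brought to the front.\<close>

lemma sG_divisible:
  assumes "x \<in> Y"
  obtains t where "fs_word Y t" "sG \<approx> [x] @ t"
proof -
  obtain A B where AB: "concat cls = A @ x # B"
    using assms set_enum by (metis split_list)
  have A: "set A \<subseteq> Y" and B: "set B \<subseteq> Y" using set_enum AB by auto
  obtain q where q: "p x = Suc q" using p_pos[OF assms] by (cases "p x") auto
  let ?t = "replicate q x @ blocks p A @ blocks p B"
  have "(blocks p A @ replicate (p x) x) @ blocks p B
      \<approx> (replicate (p x) x @ blocks p A) @ blocks p B"
    using A B assms by (intro fs_eq_append_right central_word_commute central_word_power fs_word_blocks)
  then have "sG \<approx> [x] @ ?t" by (simp add: sG_eq AB q)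
  moreover have "fs_word Y ?t" using A B assms by (simp add: fs_word_blocks)
  ultimately show ?thesis using that by blast
qed

text \<open>Each copy of \<open>sG\<close> supplies one letter of s; centrality moves the remaining
  copies past the cofactor r left over from it.\<close>

lemma power_divides_sG_pow:
  assumes "fs_word Y s"
  shows "\<exists>t. fs_word Y t \<and> fs_pow sG (length s) \<approx> s @ t"
  using assms
proof (induction s)
  case Nil
  then show ?case by (intro exI[of _ "[]"]) (simp add: fs_refl)
next
  case (Cons x s)
  then obtain t where t: "fs_word Y t" "fs_pow sG (length s) \<approx> s @ t" by auto
  obtain r where r: "fs_word Y r" "sG \<approx> [x] @ r" using sG_divisible Cons by auto
  have c: "central_word (fs_pow sG (length s))" by (intro central_fs_pow central_sG)
  have "sG @ fs_pow sG (length s) \<approx> ([x] @ r) @ fs_pow sG (length s)"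
    using c r by (intro fs_eq_append_right central_word_is_word)
  also have "([x] @ r) @ fs_pow sG (length s) = [x] @ (r @ fs_pow sG (length s))" by simp
  also have "\<dots> \<approx> [x] @ (fs_pow sG (length s) @ r)"
    using c r Cons.prems by (intro fs_eq_append_left central_word_commute) auto
  also have "\<dots> \<approx> [x] @ ((s @ t) @ r)"
    using t r Cons.prems by (intro fs_eq_append_left fs_eq_append_right) auto
  finally show ?case using t r by (intro exI[of _ "t @ r"]) simp
qed

text \<open>The power is a multiple of s, so an equality after multiplying by s persists. Hence only
  the length of an equalizing element matters, which is why e is defined through lengths.\<close>

lemma sG_pow_cancels:
  assumes s: "fs_word Y s" and eq: "u @ s \<approx> v @ s" and n: "length s \<le> n"
  shows "u @ fs_pow sG n \<approx> v @ fs_pow sG n"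
proof -
  obtain t where t: "fs_word Y t" "fs_pow sG (length s) \<approx> s @ t"
    using power_divides_sG_pow[OF s] by blast
  define m where "m = n - length s"
  have m: "fs_pow sG n = fs_pow sG (length s) @ fs_pow sG m"
    using n by (simp add: m_def fs_pow_add[symmetric])
  have wm: "fs_word Y (fs_pow sG m)" using central_fs_pow central_sG central_word_is_word by blast
  have *: "w @ fs_pow sG n \<approx> (w @ s) @ t @ fs_pow sG m" if "fs_word Y w" for w
    using fs_eq_append_left[OF that fs_eq_append_right[OF wm t(2)]] by (simp add: m)
  have uv: "fs_word Y u" "fs_word Y v" using fs_eq_word[OF eq] by auto
  have "u @ fs_pow sG n \<approx> (u @ s) @ t @ fs_pow sG m" by (rule *[OF uv(1)])
  also have "\<dots> \<approx> (v @ s) @ t @ fs_pow sG m"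
    using t wm by (intro fs_eq_append_right eq) auto
  also have "\<dots> \<approx> v @ fs_pow sG n" by (rule fs_sym[OF *[OF uv(2)]])
  finally show ?thesis .
qed

section \<open>Exchange of conjugate central powers\<close>

text \<open>Moving x to the front turns every y into y'; moving x back past the resulting power,
  which is central, changes nothing.\<close>

lemma power_conj_letter:
  assumes "x \<in> Y" "y \<in> Y"
  defines "y' \<equiv> inv x \<otimes> y \<otimes> x"
  shows "replicate (p y) y @ [x] \<approx> replicate (p y') y' @ [x]"
proof -
  have y': "y' \<in> Y" using assms by (simp add: Y_conj Y_carrier)
  have pp: "p y' = p y" using assms by (simp add: central_exp_conj Y_carrier)
  have "replicate (p y) y @ [x] \<approx> [x] @ replicate (p y) y'"
    using word_move_left[of "replicate (p y) y" x] assms by simp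
  also have "\<dots> \<approx> replicate (p y') y' @ [x]"
    unfolding pp[symmetric] using y' assms by (intro central_word_commute central_word_power) auto
  finally show ?thesis .
qed

text \<open>The letter x required for the exchange is split off from \<open>sG\<close> and then
  returned to it.\<close>

lemma power_conj_letter_sG:
  assumes "x \<in> Y" "y \<in> Y"
  defines "y' \<equiv> inv x \<otimes> y \<otimes> x"
  shows "replicate (p y) y @ sG \<approx> replicate (p y') y' @ sG"
proof -
  have y': "y' \<in> Y" using assms by (simp add: Y_conj Y_carrier)
  obtain t where t: "fs_word Y t" "sG \<approx> [x] @ t" using sG_divisible assms by blast
  have "replicate (p y) y @ sG \<approx> replicate (p y) y @ ([x] @ t)"
    using t assms by (intro fs_eq_append_left) auto
  also have "\<dots> = (replicate (p y) y @ [x]) @ t" by simp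
  also have "\<dots> \<approx> (replicate (p y') y' @ [x]) @ t"
    unfolding y'_def using t assms by (intro fs_eq_append_right power_conj_letter) auto
  also have "\<dots> = replicate (p y') y' @ ([x] @ t)" by simp
  also have "\<dots> \<approx> replicate (p y') y' @ sG"
    using t y' by (intro fs_eq_append_left fs_sym[OF t(2)]) auto
  finally show ?thesis .
qed

lemma power_conj_sG:
  assumes "g \<in> carrier G" "y \<in> Y" "y' = inv g \<otimes> y \<otimes> g"
  shows "replicate (p y) y @ sG \<approx> replicate (p y') y' @ sG"
  using assms
proof (induction arbitrary: y y' rule: generated_induct)
  case one
  then show ?case using word_sG by (simp add: Y_carrier fs_refl)
next
  case (gen x g)
  let ?y = "inv x \<otimes> y \<otimes> x"
  have "y' = inv g \<otimes> ?y \<otimes> g" using gen by (simp add: conj_conj Y_carrier)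
  then have "replicate (p ?y) ?y @ sG \<approx> replicate (p y') y' @ sG"
    using gen.IH[of ?y y'] gen.prems gen.hyps by (simp add: Y_conj Y_carrier)
  with power_conj_letter_sG[of x y] gen show ?case using fs_trans by blast
next
  case (gen_inv x g)
  let ?y = "x \<otimes> y \<otimes> inv x"
  have y: "?y \<in> Y" using gen_inv by (simp add: Y_conj' Y_carrier)
  have "y' = inv g \<otimes> ?y \<otimes> g"
    using gen_inv conj_conj[of y "inv x" g] by (simp add: Y_carrier)
  then have "replicate (p ?y) ?y @ sG \<approx> replicate (p y') y' @ sG"
    using gen_inv.IH[of ?y y'] y by simp
  \<comment> \<open>Conjugation by an inverse generator is the one-letter exchange read backwards,
    started from x y x^-1.\<close>
  moreover have "replicate (p y) y @ sG \<approx> replicate (p ?y) ?y @ sG"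
    using power_conj_letter_sG[of x ?y] gen_inv y by (simp add: conj_conj_inv Y_carrier fs_sym)
  ultimately show ?case using fs_trans by blast
qed

lemma power_class_sG:
  assumes "c \<in> set cls" "x \<in> set c" "y \<in> set c"
  shows "replicate (p x) x @ sG \<approx> replicate (p y) y @ sG"
  using class_conjugate[OF assms] power_conj_sG[of _ x y] class_subset assms by (metis subsetD)

lemma blocks_extract:
  assumes "set A \<subseteq> Y" "set B \<subseteq> Y" "y \<in> Y"
  shows "blocks p (A @ y # B) \<approx> replicate (p y) y @ blocks p (A @ B)"
proof -
  have "(blocks p A @ replicate (p y) y) @ blocks p B
      \<approx> (replicate (p y) y @ blocks p A) @ blocks p B"
    using assms by (intro fs_eq_append_right central_word_commute central_word_power fs_word_blocks)
  then show ?thesis by simp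
qed

lemma class_exists: "y \<in> Y \<Longrightarrow> \<exists>c\<in>set cls. y \<in> set c"
  using set_enum by auto

text \<open>The first block of \<open>blocks p ys\<close> has a positive class count, so zs contains
  some z from the same class. Exchanging the two blocks and removing them keeps all counts equal,
  since z and y have equal exponents.\<close>

lemma central_blocks_same_type:
  assumes "set ys \<subseteq> Y" "set zs \<subseteq> Y"
    and "\<And>c. c \<in> set cls \<Longrightarrow> class_count c (blocks p ys) = class_count c (blocks p zs)"
  shows "blocks p ys @ sG \<approx> blocks p zs @ sG"
  using assms
proof (induction ys arbitrary: zs)
  case Nil
  \<comment> \<open>Every block contributes at least one letter, so a product of blocks with all
    counts zero has no blocks.\<close>
  have "zs = []"
  proof (cases zs)
    case (Cons z zs')
    then obtain c where "c \<in> set cls" "z \<in> set c" using class_exists[of z] Nil by auto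
    then show ?thesis using Nil(3)[of c] Cons p_pos[of z] Nil(2) by auto
  qed
  then show ?case using word_sG by (simp add: fs_refl)
next
  case (Cons y ys)
  have y: "y \<in> Y" "set ys \<subseteq> Y" using Cons by auto
  obtain c where c: "c \<in> set cls" "y \<in> set c" using class_exists y by blast
  have "class_count c (blocks p zs) > 0"
    using Cons.prems(3)[OF c(1)] c(2) p_pos[OF y(1)] by simp
  then have "set c \<inter> set zs \<noteq> {}" using class_count_blocks_outside by fastforce
  then obtain z A B where z: "z \<in> set c" "zs = A @ z # B" by (metis disjoint_iff split_list)
  have AB: "z \<in> Y" "set A \<subseteq> Y" "set B \<subseteq> Y" using z Cons.prems by auto
  have same: "z \<in> set d \<longleftrightarrow> y \<in> set d" "p z = p y" if "d \<in> set cls" for d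
  proof -
    obtain g where "g \<in> carrier G" "z = inv g \<otimes> y \<otimes> g" using class_conjugate c z by blast
    then show "z \<in> set d \<longleftrightarrow> y \<in> set d" "p z = p y"
      using class_conj_iff[OF that y(1)] y by (auto simp: central_exp_conj Y_carrier)
  qed
  have IH: "blocks p ys @ sG \<approx> blocks p (A @ B) @ sG"
  proof (rule Cons.IH)
    show "set ys \<subseteq> Y" "set (A @ B) \<subseteq> Y" using y AB by auto
    fix d assume "d \<in> set cls"
    then show "class_count d (blocks p ys) = class_count d (blocks p (A @ B))"
      using Cons.prems(3)[of d] same[of d] z by (auto split: if_splits)
  qed
  have "replicate (p y) y @ (blocks p ys @ sG) \<approx> replicate (p y) y @ (blocks p (A @ B) @ sG)"
    using y by (intro fs_eq_append_left IH) auto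
  \<comment> \<open>\<open>sG\<close> is carried next to the block to be exchanged, and carried back
    afterwards.\<close>
  also have "\<dots> \<approx> replicate (p y) y @ (sG @ blocks p (A @ B))"
    using y AB by (intro fs_eq_append_left central_word_commute central_sG fs_word_blocks) auto
  also have "\<dots> = (replicate (p y) y @ sG) @ blocks p (A @ B)" by simp
  also have "\<dots> \<approx> (replicate (p z) z @ sG) @ blocks p (A @ B)"
    using c z AB by (intro fs_eq_append_right power_class_sG fs_word_blocks) auto
  also have "\<dots> = replicate (p z) z @ (sG @ blocks p (A @ B))" by simp
  also have "\<dots> \<approx> replicate (p z) z @ (blocks p (A @ B) @ sG)"
    using AB
    by (intro fs_eq_append_left fs_sym[OF central_word_commute] central_sG fs_word_blocks) auto
  also have "\<dots> = (replicate (p z) z @ blocks p (A @ B)) @ sG" by simp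
  also have "\<dots> \<approx> blocks p zs @ sG"
    unfolding z using AB by (intro fs_eq_append_right fs_sym[OF blocks_extract] word_sG) auto
  finally show ?case by simp
qed

subsection \<open>Equality in the group implies equivalence in the semigroup\<close>

text \<open>The inverse of \<open>y\<close> is represented by \<open>y\<^sup>p\<^sup>-\<^sup>1\<close>, which is correct up to the central element
  \<open>y\<^sup>p\<close>.\<close>
definition positive_word :: "('a \<times> bool) list \<Rightarrow> 'a list" where
  "positive_word w = concat (map (\<lambda>(y, b). if b then [y] else replicate (p y - 1) y) w)"

lemma positive_word_simps [simp]:
  "positive_word [] = []"
  "positive_word ((y, b) # w) = (if b then [y] else replicate (p y - 1) y) @ positive_word w"
  "positive_word (v @ w) = positive_word v @ positive_word w"
  by (simp_all add: positive_word_def)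

lemma fs_word_positive_word: "Y_letters Y w \<Longrightarrow> fs_word Y (positive_word w)"
  by (induction w) (auto simp: Y_letters_def)

lemma positive_word_map: "positive_word (map (\<lambda>y. (y, True)) s) = s"
  by (induction s) auto

lemma replicate_pred_p:
  assumes "y \<in> Y"
  shows "replicate (p y - 1) y @ y # u = replicate (p y) y @ u"
    and "y # replicate (p y - 1) y @ u = replicate (p y) y @ u"
proof -
  obtain q where "p y = Suc q" using p_pos[OF assms] by (cases "p y") auto
  then show "replicate (p y - 1) y @ y # u = replicate (p y) y @ u"
    "y # replicate (p y - 1) y @ u = replicate (p y) y @ u"
    by (simp_all add: replicate_app_Cons_same)
qed

text \<open>Induction on the derivation. Replacing inverses by positive powers makes the group
  relations hold only up to central blocks, so each side carries its own multiplier; transitivity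
  cross-multiplies them.\<close>

lemma pres_eq_positive_word:
  "pres_eq G Y v w \<Longrightarrow> \<exists>ys zs. set ys \<subseteq> Y \<and> set zs \<subseteq> Y
     \<and> positive_word v @ blocks p ys \<approx> positive_word w @ blocks p zs"
proof (induction rule: pres_eq.induct)
  case (pres_refl w)
  then show ?case
    by (intro exI[of _ "[]"]) (simp add: fs_refl fs_word_positive_word)
next
  case (pres_sym v w)
  then show ?case using fs_sym by blast
next
  case (pres_trans u v w)
  obtain a b where ab: "set a \<subseteq> Y" "set b \<subseteq> Y"
    "positive_word u @ blocks p a \<approx> positive_word v @ blocks p b"
    using pres_trans.IH(1) by blast
  obtain c d where cd: "set c \<subseteq> Y" "set d \<subseteq> Y"
    "positive_word v @ blocks p c \<approx> positive_word w @ blocks p d"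
    using pres_trans.IH(2) by blast
  have v: "fs_word Y (positive_word v)" using fs_eq_word[OF ab(3)] by simp
  have "(positive_word u @ blocks p a) @ blocks p c \<approx> (positive_word v @ blocks p b) @ blocks p c"
    using ab cd by (intro fs_eq_append_right fs_word_blocks)
  also have "\<dots> = positive_word v @ (blocks p b @ blocks p c)" by simp
  also have "\<dots> \<approx> positive_word v @ (blocks p c @ blocks p b)"
    using ab cd v by (intro fs_eq_append_left central_word_commute central_word_blocks fs_word_blocks)
  also have "\<dots> = (positive_word v @ blocks p c) @ blocks p b" by simp
  also have "\<dots> \<approx> (positive_word w @ blocks p d) @ blocks p b"
    using ab cd by (intro fs_eq_append_right fs_word_blocks)
  finally show ?case using ab cd by (intro exI[of _ "a @ c"] exI[of _ "d @ b"]) simp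
next
  case (pres_free y b)
  \<comment> \<open>A cancelling pair becomes y^p rather than the identity, and the block of y on
    the right accounts for it.\<close>
  have "positive_word [(y, b), (y, \<not> b)] @ blocks p [] \<approx> positive_word [] @ blocks p [y]"
    using replicate_pred_p[OF pres_free, of "[]"] pres_free by (cases b) (auto simp: fs_refl)
  then show ?case using pres_free by (intro exI[of _ "[]"] exI[of _ "[y]"]) simp
next
  case (pres_rel y z y')
  have y': "y' \<in> Y" and z: "z \<in> Y" using pres_rel by auto
  \<comment> \<open>In z^(p-1) y z the last two letters become z y', which completes the central
    power z^p.\<close>
  have "replicate (p z - 1) z @ [y, z] \<approx> replicate (p z - 1) z @ [z, y']"
    using fs_rel1[of y Y z G] pres_rel by (intro fs_eq_append_left) auto
  also have "\<dots> = replicate (p z) z @ [y']" using replicate_pred_p[OF z, of "[y']"] by simp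
  also have "\<dots> \<approx> [y'] @ replicate (p z) z"
    using y' z by (intro fs_sym[OF central_word_commute] central_word_power) auto
  finally show ?case
    using z by (intro exI[of _ "[]"] exI[of _ "[z]"]) simp
next
  case (pres_cong v v' u w)
  obtain a b where ab: "set a \<subseteq> Y" "set b \<subseteq> Y"
    "positive_word v @ blocks p a \<approx> positive_word v' @ blocks p b"
    using pres_cong.IH by blast
  have uw: "fs_word Y (positive_word u)" "fs_word Y (positive_word w)"
    using pres_cong by (auto intro: fs_word_positive_word)
  have vv': "fs_word Y (positive_word v)" "fs_word Y (positive_word v')"
    using fs_eq_word[OF ab(3)] by auto
  have comm: "positive_word x @ (positive_word w @ blocks p c)
      \<approx> positive_word x @ (blocks p c @ positive_word w)"
    if "fs_word Y (positive_word x)" "set c \<subseteq> Y" for x c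
    using that uw by (intro fs_eq_append_left central_word_commute central_word_blocks)
  have "positive_word u @ (positive_word v @ (positive_word w @ blocks p a))
      \<approx> positive_word u @ (positive_word v @ (blocks p a @ positive_word w))"
    using uw vv' ab by (intro fs_eq_append_left comm)
  also have "\<dots> = positive_word u @ (positive_word v @ blocks p a) @ positive_word w" by simp
  also have "\<dots> \<approx> positive_word u @ (positive_word v' @ blocks p b) @ positive_word w"
    using uw by (intro fs_cong ab)
  also have "\<dots> = positive_word u @ (positive_word v' @ (blocks p b @ positive_word w))" by simp
  also have "\<dots> \<approx> positive_word u @ (positive_word v' @ (positive_word w @ blocks p b))"
    using uw vv' ab by (intro fs_eq_append_left fs_sym[OF comm])
  finally show ?case using ab by (intro exI[of _ a] exI[of _ b]) simp
qed

lemma word_eval_positive: "word_eval G (map (\<lambda>y. (y, True)) s) = fs_alpha G s"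
  by (induction s) (simp_all add: word_eval_def letter_val_def)

text \<open>The presentation of G gives equality up to two central multipliers. Equal types of s and
  t force equal types of these multipliers, and \<open>sG\<close> then identifies them.\<close>

lemma same_alpha_type_equiv:
  assumes st: "fs_word Y s" "fs_word Y t"
    and alpha: "fs_alpha G s = fs_alpha G t"
    and type: "\<And>c. c \<in> set cls \<Longrightarrow> class_count c s = class_count c t"
  shows "\<exists>u. fs_word Y u \<and> s @ u \<approx> t @ u"
proof -
  have "pres_eq G Y (map (\<lambda>y. (y, True)) s) (map (\<lambda>y. (y, True)) t)"
    using st alpha
    by (intro presented) (auto simp: Y_letters_def fs_word_def word_eval_positive)
  from pres_eq_positive_word[OF this] obtain ys zs where
    yz: "set ys \<subseteq> Y" "set zs \<subseteq> Y" "s @ blocks p ys \<approx> t @ blocks p zs"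
    by (auto simp: positive_word_map)
  have "class_count c (blocks p ys) = class_count c (blocks p zs)" if "c \<in> set cls" for c
    using fs_eq_class_count[OF that yz(3)] type[OF that] by simp
  then have *: "blocks p ys @ sG \<approx> blocks p zs @ sG"
    using yz by (intro central_blocks_same_type)
  have "s @ (blocks p ys @ sG) = (s @ blocks p ys) @ sG" by simp
  also have "\<dots> \<approx> (t @ blocks p zs) @ sG" using yz(3) word_sG by (intro fs_eq_append_right)
  also have "\<dots> = t @ (blocks p zs @ sG)" by simp
  also have "\<dots> \<approx> t @ (blocks p ys @ sG)" using st by (intro fs_eq_append_left fs_sym[OF *])
  finally show ?thesis using yz word_sG by (intro exI[of _ "blocks p ys @ sG"]) (simp add: fs_word_blocks)
qed

subsection \<open>Normal forms\<close>

text \<open>The letters of L are collected one after another at the front. The hypothesis ranges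
  over all words representing s, since moving a letter can create new letters by
  conjugation.\<close>

lemma normal_form_aux:
  assumes "fs_word Y s" "\<And>w. s \<approx> w \<Longrightarrow> set w \<subseteq> set L" "distinct L" "set L \<subseteq> Y"
  shows "\<exists>k. s \<approx> blocks k L"
  using assms
proof (induction L arbitrary: s)
  case Nil
  then have "s = []" using fs_refl[of Y s G] by fastforce
  then show ?case by (simp add: fs_refl)
next
  case (Cons y L)
  have y: "y \<in> Y" using Cons.prems by simp
  \<comment> \<open>The largest power of y that splits off on the left of any representative; it
    exists because equivalent words have the same length.\<close>
  let ?P = "\<lambda>n. \<exists>w. s \<approx> replicate n y @ w"
  have "?P 0" using fs_refl[of Y s G] Cons.prems by auto
  moreover have "n \<le> length s" if "?P n" for n
    using that fs_eq_length by fastforce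
  ultimately obtain n where n: "?P n" and max: "\<And>m. ?P m \<Longrightarrow> m \<le> n"
    using Nat.ex_has_greatest_nat[of ?P 0 "length s"] by blast
  then obtain w where w: "s \<approx> replicate n y @ w" by blast
  have w_word: "fs_word Y w" using fs_eq_word[OF w] by simp
  have "\<exists>k. w \<approx> blocks k L"
  proof (rule Cons.IH)
    fix v assume v: "w \<approx> v"
    have "replicate n y @ w \<approx> replicate n y @ v" using v y by (intro fs_eq_append_left) auto
    with w have sv: "s \<approx> replicate n y @ v" by (rule fs_trans)
    \<comment> \<open>A further y could be moved left to join the others, against maximality. So y
      occurs in no representative of the remainder, and the induction hypothesis applies to
      L.\<close>
    have "y \<notin> set v"
    proof
      assume "y \<in> set v"
      then obtain a b where ab: "v = a @ y # b" by (meson split_list)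
      have ab_word: "fs_word Y a" "fs_word Y b" using fs_eq_word[OF v] ab by auto
      let ?a = "map (\<lambda>x. inv y \<otimes> x \<otimes> y) a"
      have "s \<approx> replicate n y @ (a @ [y]) @ b" using sv by (simp add: ab)
      also have "\<dots> \<approx> replicate n y @ (y # ?a) @ b"
        using ab_word y by (intro fs_cong word_move_left) auto
      finally have "s \<approx> replicate (Suc n) y @ (?a @ b)" by (simp add: replicate_app_Cons_same)
      then show False using max[of "Suc n"] by auto
    qed
    then show "set v \<subseteq> set L" using Cons.prems(2)[OF sv] by auto
  qed (use Cons.prems w_word in auto)
  then obtain k where k: "w \<approx> blocks k L" by blast
  have "blocks (k(y := n)) L = blocks k L" using Cons.prems by (intro blocks_cong) auto
  moreover have "replicate n y @ w \<approx> replicate n y @ blocks k L"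
    using k y by (intro fs_eq_append_left) auto
  ultimately have "s \<approx> blocks (k(y := n)) (y # L)" using fs_trans[OF w] by simp
  then show ?case by blast
qed

lemma normal_form: "fs_word Y s \<Longrightarrow> \<exists>k. s \<approx> ordered_prod cls k"
  unfolding ordered_prod_eq_blocks
proof (rule normal_form_aux)
  show "set w \<subseteq> set (concat cls)" if "s \<approx> w" for w
    using fs_eq_word[OF that] set_enum by (simp add: fs_word_def)
qed (use distinct_enum set_enum in auto)

lemma ordered_prod_word: "fs_word Y (ordered_prod cls k)"
  unfolding ordered_prod_eq_blocks using set_enum by (intro fs_word_blocks) auto

text \<open>Part of the y-block forms a full central power, which moves past all later blocks to the
  end.\<close>

lemma ordered_prod_split_power:
  assumes y: "y \<in> Y" and k: "p y \<le> k y"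
  shows "ordered_prod cls k \<approx> ordered_prod cls (k(y := k y - p y)) @ replicate (p y) y"
proof -
  obtain A B where AB: "concat cls = A @ y # B" using y set_enum by (metis split_list)
  have notin: "y \<notin> set A" "y \<notin> set B" using distinct_enum unfolding AB by auto
  have sub: "set A \<subseteq> Y" "set B \<subseteq> Y" using set_enum AB by auto
  let ?k = "k(y := k y - p y)"
  have same: "blocks k A = blocks ?k A" "blocks k B = blocks ?k B"
    using notin by (auto intro!: blocks_cong)
  let ?u = "blocks ?k A @ replicate (k y - p y) y"
  have u: "fs_word Y ?u" using sub y by (simp add: fs_word_blocks)
  have "replicate (k y) y = replicate (k y - p y) y @ replicate (p y) y"
    using k by (simp add: replicate_add[symmetric])
  then have "ordered_prod cls k = ?u @ (replicate (p y) y @ blocks ?k B)"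
    by (simp add: ordered_prod_eq_blocks AB same)
  also have "\<dots> \<approx> ?u @ (blocks ?k B @ replicate (p y) y)"
    using u y sub
    by (intro fs_eq_append_left fs_sym[OF central_word_commute] central_word_power fs_word_blocks)
  finally show ?thesis
    by (simp add: ordered_prod_eq_blocks AB fun_upd_same del: fun_upd_apply)
qed

lemma pigeonhole_class:
  assumes "\<not> sum_list (map k c) \<le> m * length c"
  shows "\<exists>y\<in>set c. m \<le> k y"
proof (rule ccontr)
  assume "\<not> ?thesis"
  then have "sum_list (map k c) \<le> sum_list (map (\<lambda>_. m) c)"
    by (intro sum_list_mono) auto
  then show False using assms by (simp add: sum_list_triv mult.commute)
qed

subsection \<open>The bound on the exponent\<close>

text \<open>The class bounds limit the length of the words, and Y is finite. Finiteness is what lets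
  \<open>Max\<close> bound every value in the definition of e.\<close>

lemma finite_R: "finite (R_set G cls)"
proof -
  let ?N = "sum_list (map (\<lambda>c. p (hd c) * length c) cls)"
  have len: "length (blocks k ys) = sum_list (map k ys)" for k :: "'a \<Rightarrow> nat" and ys
    by (induction ys) auto
  have *: "length (ordered_prod cs k) \<le> sum_list (map (\<lambda>c. p (hd c) * length c) cs)"
    if "\<forall>c\<in>set cs. sum_list (map k c) \<le> p (hd c) * length c" for cs k
    using that by (induction cs) (auto simp: ordered_prod_eq_blocks len intro: add_mono)
  have "R_set G cls \<subseteq> {w. set w \<subseteq> Y \<and> length w \<le> ?N}"
    using * ordered_prod_word by (auto simp: R_set_def fs_word_def)
  then show ?thesis
    using finite_lists_length_le[OF fin_Y, of ?N] finite_subset by blast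
qed

abbreviation e where "e \<equiv> e_Gamma G Y cls"

lemma R_stabilized:
  assumes R: "s \<in> R_set G cls" "t \<in> R_set G cls"
    and alpha: "fs_alpha G s = fs_alpha G t"
    and type: "\<And>c. c \<in> set cls \<Longrightarrow> class_count c s = class_count c t"
  shows "s @ fs_pow sG e \<approx> t @ fs_pow sG e"
proof -
  have st: "fs_word Y s" "fs_word Y t" using R ordered_prod_word by (auto simp: R_set_def)
  obtain u where u: "fs_word Y u" "s @ u \<approx> t @ u"
    using same_alpha_type_equiv[OF st alpha type] by blast
  have "fs_equiv G Y s t"
    unfolding fs_equiv_def using u by (intro exI[of _ "[]"] exI[of _ u]) simp
  then have E: "(s, t) \<in> E_set G Y cls" using R by (simp add: E_set_def)
  have "E_set G Y cls \<subseteq> R_set G cls \<times> R_set G cls" by (auto simp: E_set_def)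
  then have "finite (E_set G Y cls)" using finite_R finite_subset by blast
  then have le: "e_fun G Y s t \<le> e"
    unfolding e_Gamma_def using E by (intro Max_ge) (auto intro: rev_image_eqI)
  \<comment> \<open>The word \<open>u\<close> shows that the set under LEAST is nonempty, so the
    minimum is attained.\<close>
  have "\<exists>u. fs_word Y u \<and> length u = e_fun G Y s t \<and> s @ u \<approx> t @ u"
    unfolding e_fun_def by (rule LeastI_ex) (use u in blast)
  then show ?thesis using sG_pow_cancels le by fastforce
qed

section \<open>Reduction of arbitrary pairs to R\<close>

lemma power_in_R:
  assumes c: "c \<in> set cls" and y: "y \<in> set c"
  shows "replicate (p y) y \<in> R_set G cls"
proof -
  let ?k = "(\<lambda>_. 0)(y := p y)"
  have zero: "blocks ?k ys = []" if "y \<notin> set ys" for ys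
    using that by (induction ys) auto
  obtain A B where AB: "concat cls = A @ y # B"
    using c y set_enum class_subset by (metis split_list subsetD)
  have notin: "y \<notin> set A" "y \<notin> set B" using distinct_enum unfolding AB by auto
  have eq: "ordered_prod cls ?k = replicate (p y) y"
    using notin by (simp add: ordered_prod_eq_blocks AB zero)
  have "sum_list (map ?k d) \<le> p (hd d) * length d" if d: "d \<in> set cls" for d
  proof (cases "y \<in> set d")
    case True
    have "sum_list (map ?k d) = p y"
      using class_count_ordered_prod[OF d, of ?k] True unfolding eq by simp
    moreover have "1 \<le> length d" using True by (cases d) auto
    ultimately show ?thesis using p_class[OF d True] by simp
  next
    case False
    then show ?thesis using class_count_ordered_prod[OF d, of ?k] unfolding eq by simp
  qed
  then show ?thesis using eq unfolding R_set_def by (intro CollectI exI[of _ ?k]) simp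
qed

text \<open>Both powers agree in the semigroup after multiplication by \<open>sG\<close>, whose
  product cancels in G.\<close>

lemma power_class_same_alpha:
  assumes "c \<in> set cls" "x \<in> set c" "y \<in> set c"
  shows "fs_alpha G (replicate (p x) x) = fs_alpha G (replicate (p y) y)"
proof -
  have xy: "x \<in> Y" "y \<in> Y" using assms class_subset by auto
  have "fs_alpha G (replicate (p x) x @ sG) = fs_alpha G (replicate (p y) y @ sG)"
    by (rule fs_eq_alpha[OF power_class_sG[OF assms]])
  then show ?thesis using xy word_sG by simp
qed

lemma power_class_same_type:
  assumes "c \<in> set cls" "x \<in> set c" "y \<in> set c" "d \<in> set cls"
  shows "class_count d (replicate (p x) x) = class_count d (replicate (p y) y)"
  using fs_eq_class_count[OF assms(4) power_class_sG[OF assms(1-3)]] by simp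

text \<open>The earlier exchange consumes a factor \<open>sG\<close>, which is absent when e = 0.
  Treating the two powers as members of R covers every value of e.\<close>

lemma power_class_stabilized:
  assumes "c \<in> set cls" "x \<in> set c" "y \<in> set c"
  shows "replicate (p x) x @ fs_pow sG e \<approx> replicate (p y) y @ fs_pow sG e"
  using assms
  by (intro R_stabilized power_in_R power_class_same_alpha power_class_same_type) auto

text \<open>Induction on length: either both normal forms lie in R, or a central power from a common
  class is split off each and the shorter remainders are compared.\<close>

lemma stabilized:
  assumes "fs_word Y s" "fs_word Y t" "fs_alpha G s = fs_alpha G t"
    and "\<And>c. c \<in> set cls \<Longrightarrow> class_count c s = class_count c t"
  shows "s @ fs_pow sG e \<approx> t @ fs_pow sG e"
  using assms
proof (induction "length s" arbitrary: s t rule: less_induct)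
  case less
  let ?Z = "fs_pow sG e"
  have cZ: "central_word ?Z" by (intro central_fs_pow central_sG)
  then have Z: "fs_word Y ?Z" by (rule central_word_is_word)
  obtain k where k: "s \<approx> ordered_prod cls k" using normal_form less.prems by blast
  obtain l where l: "t \<approx> ordered_prod cls l" using normal_form less.prems by blast
  have sum_k: "sum_list (map k c) = class_count c s" if "c \<in> set cls" for c
    using fs_eq_class_count[OF that k] class_count_ordered_prod[OF that] by simp
  have sum_l: "sum_list (map l c) = class_count c s" if "c \<in> set cls" for c
    using fs_eq_class_count[OF that l] class_count_ordered_prod[OF that] less.prems(4)[OF that] by simp
  show ?case
  \<comment> \<open>Membership of the normal forms in R is read off from the type, which s and t
    share, so one test decides for both.\<close>
  proof (cases "\<forall>c\<in>set cls. class_count c s \<le> p (hd c) * length c")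
    case True
    have "ordered_prod cls k @ ?Z \<approx> ordered_prod cls l @ ?Z"
    proof (rule R_stabilized)
      show "ordered_prod cls k \<in> R_set G cls" "ordered_prod cls l \<in> R_set G cls"
        using True sum_k sum_l unfolding R_set_def by fastforce+
    qed (use fs_eq_alpha[OF k] fs_eq_alpha[OF l] less.prems fs_eq_class_count[OF _ k]
          fs_eq_class_count[OF _ l] in simp_all)
    then show ?thesis
      using fs_eq_append_right[OF Z k] fs_sym[OF fs_eq_append_right[OF Z l]] fs_trans by blast
  next
    case False
    then obtain c where c: "c \<in> set cls" "\<not> class_count c s \<le> p (hd c) * length c" by blast
    \<comment> \<open>The letters x and y may differ, but they lie in the same class c, so their
      central powers have equal product and type.\<close>
    obtain x where x: "x \<in> set c" "p (hd c) \<le> k x"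
      using pigeonhole_class[of k c "p (hd c)"] c sum_k by auto
    obtain y where y: "y \<in> set c" "p (hd c) \<le> l y"
      using pigeonhole_class[of l c "p (hd c)"] c sum_l by auto
    have xy: "x \<in> Y" "y \<in> Y" using x y c class_subset by auto
    let ?x = "replicate (p x) x" and ?y = "replicate (p y) y"
    define s' where "s' = ordered_prod cls (k(x := k x - p x))"
    define t' where "t' = ordered_prod cls (l(y := l y - p y))"
    have s: "s \<approx> s' @ ?x"
      using fs_trans[OF k ordered_prod_split_power, of x] x xy p_class[OF c(1) x(1)] by (simp add: s'_def)
    have t: "t \<approx> t' @ ?y"
      using fs_trans[OF l ordered_prod_split_power, of y] y xy p_class[OF c(1) y(1)] by (simp add: t'_def)
    have w: "fs_word Y s'" "fs_word Y t'" by (simp_all add: s'_def t'_def ordered_prod_word)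
    have xy_word: "fs_word Y ?x" "fs_word Y ?y" using xy by auto
    have IH: "s' @ ?Z \<approx> t' @ ?Z"
    proof (rule less.hyps)
      show "length s' < length s" using fs_eq_length[OF s] p_pos[OF xy(1)] by simp
      have "fs_alpha G s' \<otimes> fs_alpha G ?x = fs_alpha G t' \<otimes> fs_alpha G ?y"
        using fs_eq_alpha[OF s] fs_eq_alpha[OF t] less.prems(3) w xy_word by simp
      then show "fs_alpha G s' = fs_alpha G t'"
        using power_class_same_alpha[OF c(1) x(1) y(1)] w xy_word by simp
      fix d assume d: "d \<in> set cls"
      show "class_count d s' = class_count d t'"
        using fs_eq_class_count[OF d s] fs_eq_class_count[OF d t] less.prems(4)[OF d]
          power_class_same_type[OF c(1) x(1) y(1) d] by simp
    qed (use w in auto)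
    \<comment> \<open>First \<open>?x\<close> is exchanged for \<open>?y\<close> next to
      \<open>?Z\<close>; then \<open>?Z\<close> moves next to s' so that the induction hypothesis
      can replace s' by t'.\<close>
    have "s @ ?Z \<approx> (s' @ ?x) @ ?Z" by (intro fs_eq_append_right Z s)
    also have "\<dots> = s' @ (?x @ ?Z)" by simp
    also have "\<dots> \<approx> s' @ (?y @ ?Z)"
      using c x y by (intro fs_eq_append_left w power_class_stabilized) auto
    also have "\<dots> \<approx> s' @ (?Z @ ?y)"
      by (intro fs_eq_append_left w central_word_commute cZ xy_word)
    also have "\<dots> = (s' @ ?Z) @ ?y" by simp
    also have "\<dots> \<approx> (t' @ ?Z) @ ?y" by (intro fs_eq_append_right xy_word IH)
    also have "\<dots> = t' @ (?Z @ ?y)" by simp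
    also have "\<dots> \<approx> t' @ (?y @ ?Z)"
      by (intro fs_eq_append_left w fs_sym[OF central_word_commute] cZ xy_word)
    also have "\<dots> = (t' @ ?y) @ ?Z" by simp
    also have "\<dots> \<approx> t @ ?Z" by (intro fs_eq_append_right Z fs_sym[OF t])
    finally show ?thesis .
  qed
qed

lemma stabilizing_sG_pow: "stabilizing G Y cls (fs_pow sG e)"
  unfolding stabilizing_def fs_type_eq_iff
  using stabilized central_fs_pow central_sG central_word_is_word by blast

end

theorem theorem3p7:
  fixes G :: "'g monoid" and Y :: "'g set" and cls :: "'g list list"
  assumes "finite_C_group G Y"
    and "class_enumeration G Y cls"
  shows "fs_stable G Y cls \<and> stabilizing G Y cls (fs_pow (s_Gamma G cls) (e_Gamma G Y cls))"
proof -
  interpret enumerated_finite_C_group G Y cls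
    using assms by unfold_locales
  show ?thesis using stabilizing_sG_pow by (auto simp: fs_stable_def)
qed

end
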